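(* Let $\mathcal{P}$ be a class of probability distributions on the finite vocabulary $\mathcal{W}$, fix $\alpha\in(0,1)$, and assume that $\boldsymbol{P}_t\in\mathcal{P}$ for all $t\ge 1$. Then for any measurable score function $h$ satisfying $\mathbb{E}_0|h(Y)|<\infty$, the Type II error of the detection rule $T_h$ obeys $$\limsup_{n\to\infty}\ \mathbb{P}_{H_1}\big(T_h(Y_{1:n})=0\big)^{1/n}\ \le\ e^{-R_{\mathcal{P}}(h)},$$ where $$R_{\mathcal{P}}(h)=-\inf_{\theta\ge 0}\ \sup_{\boldsymbol{P}\in\mathcal{P}}\big(\theta\,\mathbb{E}_0h(Y)+\log\phi_{\boldsymbol{P},h}(\theta)\big)=-\inf_{\theta\ge0}\Big(\theta\,\mathbb{E}_0h(Y)+\sup_{\boldsymbol{P}\in\mathcal{P}}\log\phi_{\boldsymbol{P},h}(\theta)\Big).$$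
   Context: $\mathcal{W}$ is a finite set of tokens (vocabulary). A next-token-prediction (NTP) distribution is a probability vector $\boldsymbol{P}=(P_w)_{w\in\mathcal{W}}$. Let $\mu_0$ be a probability measure and, for each NTP distribution $\boldsymbol{P}$, let $\mu_{1,\boldsymbol{P}}$ be a probability measure on the same measurable space. A sequence of observed statistics $Y_1,Y_2,\dots$ is distributed as follows. - Under $H_0$: $Y_1,Y_2,\dots$ are i.i.d. with law $\mu_0$. - Under $H_1$: there is a filtration $(\mathcal{F}_t)_{t\ge0}$ (generated by the past tokens and pseudorandom variables) such that $Y_t$ is $\mathcal{F}_t$-measurable, the (possibly random) NTP distribution $\boldsymbol{P}_t$ is $\mathcal{F}_{t-1}$-measurable, and the conditional law of $Y_t$ given $\mathcal{F}_{t-1}$ is $\mu_{1,\boldsymbol{P}_t}$. $\mathbb{E}_0$ denotes expectation with $Y\sim\mu_0$, and $\mathbb{E}_{1,\boldsymbol{P}}$ expectation with $Y\sim\mu_{1,\boldsymbol{P}}$. Define $\phi_{\boldsymbol{P},h}(\theta)=\mathbb{E}_{1,\boldsymbol{P}}\,e^{-\theta h(Y)}\in(0,\infty]$. The detection rule is $T_h(Y_{1:n})=1$ if $\sum_{t=1}^n h(Y_t)\ge\gamma_{n,\alpha}$ and $T_h(Y_{1:n})=0$ otherwise, where the threshold $\gamma_{n,\alpha}$ is a real number such that $\mathbb{P}_{H_0}(T_h(Y_{1:n})=1)=\alpha$ for every $n$ (such thresholds are assumed to exist). *)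

theory Defs
  imports "HOL-Probability.Probability"
begin

definition ntp_distributions :: "(real ^ 'w::finite) set" where
  "ntp_distributions = {p. (\<forall>w. 0 \<le> p $ w) \<and> (\<Sum>w\<in>UNIV. p $ w) = 1}"

definition prob_measure_on :: "'y measure \<Rightarrow> 'y measure \<Rightarrow> bool" where
  "prob_measure_on S \<nu> \<longleftrightarrow> prob_space \<nu> \<and> sets \<nu> = sets S"

definition H0_model ::
  "'y measure \<Rightarrow> 'y measure \<Rightarrow> 'a measure \<Rightarrow> (nat \<Rightarrow> 'a \<Rightarrow> 'y) \<Rightarrow> bool" where
  "H0_model S \<mu>0 M Y \<longleftrightarrow>
     prob_space M \<and>
     prob_space.indep_vars M (\<lambda>_. S) Y {1..} \<and>
     (\<forall>t\<ge>1. distr M S (Y t) = \<mu>0)"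

text \<open>The random measure \<open>\<kappa>\<close> is the conditional law of \<open>X\<close> given \<open>G\<close>. Since conditional
  expectations are only determined up to null sets, \<open>\<omega> \<mapsto> \<kappa> \<omega> A\<close> is asked to agree almost surely
  with the conditional probability of \<open>X \<in> A\<close>; in particular it is \<open>G\<close>-measurable up to a null
  set, and no separate measurability of \<open>\<kappa>\<close> is imposed.\<close>

definition conditional_law ::
  "'b measure \<Rightarrow> 'b measure \<Rightarrow> 'y measure \<Rightarrow> ('b \<Rightarrow> 'y) \<Rightarrow> ('b \<Rightarrow> 'y measure) \<Rightarrow> bool" where
  "conditional_law M G S X \<kappa> \<longleftrightarrow>
     (\<forall>A\<in>sets S. AE \<omega> in M.
        real_cond_exp M G (\<lambda>\<omega>'. indicator A (X \<omega>')) \<omega> = measure (\<kappa> \<omega>) A)"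

definition H1_model ::
  "'y measure \<Rightarrow> (real ^ 'w::finite \<Rightarrow> 'y measure) \<Rightarrow> 'b measure \<Rightarrow> (nat \<Rightarrow> 'b measure) \<Rightarrow>
   (nat \<Rightarrow> 'b \<Rightarrow> real ^ 'w) \<Rightarrow> (nat \<Rightarrow> 'b \<Rightarrow> 'y) \<Rightarrow> bool" where
  "H1_model S \<mu>1 M F P Y \<longleftrightarrow>
     prob_space M \<and>
     filtration (space M) F \<and> (\<forall>t. subalgebra M (F t)) \<and>
     (\<forall>t\<ge>1. Y t \<in> measurable (F t) S) \<and>
     (\<forall>t\<ge>1. P t \<in> borel_measurable (F (t - 1))) \<and>
     (\<forall>t\<ge>1. \<forall>\<omega>\<in>space M. P t \<omega> \<in> ntp_distributions) \<and>
     (\<forall>t\<ge>1. conditional_law M (F (t - 1)) S (Y t) (\<lambda>\<omega>. \<mu>1 (P t \<omega>)))"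

definition detection_rule :: "('y \<Rightarrow> real) \<Rightarrow> real \<Rightarrow> nat \<Rightarrow> (nat \<Rightarrow> 'y) \<Rightarrow> nat" where
  "detection_rule h c n y = (if (\<Sum>t=1..n. h (y t)) \<ge> c then 1 else 0)"

definition phi :: "('y \<Rightarrow> real) \<Rightarrow> 'y measure \<Rightarrow> real \<Rightarrow> ennreal" where
  "phi h \<nu> \<theta> = (\<integral>\<^sup>+ y. ennreal (exp (- \<theta> * h y)) \<partial>\<nu>)"

definition ext_log :: "ennreal \<Rightarrow> ereal" where
  "ext_log x = (if x = 0 then - \<infinity> else if x = \<infinity> then \<infinity> else ereal (ln (enn2real x)))"

definition ext_exp :: "ereal \<Rightarrow> ereal" where
  "ext_exp x = (case x of ereal r \<Rightarrow> ereal (exp r) | PInfty \<Rightarrow> \<infinity> | MInfty \<Rightarrow> 0)"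

text \<open>The rate is extended-real valued: \<open>phi\<close> may be infinite, and the infimum may be \<open>-\<infinity>\<close>.\<close>

definition rate ::
  "'y measure \<Rightarrow> ('p \<Rightarrow> 'y measure) \<Rightarrow> 'p set \<Rightarrow> ('y \<Rightarrow> real) \<Rightarrow> ereal" where
  "rate \<mu>0 \<mu>1 \<P> h =
     - (INF \<theta>\<in>{0..}. SUP p\<in>\<P>.
          (ereal (\<theta> * (\<integral>y. h y \<partial>\<mu>0)) + ext_log (phi h (\<mu>1 p) \<theta>)))"

end

(* The weak law of large numbers under H0 keeps the level-alpha threshold from exceeding
   n * (E_0 h + eps) for large n, since otherwise the level would tend to 0. Under H1,
   conditioning on the past one step at a time bounds E exp (- theta * sum h(Y_t)) by the n-th
   power of the supremum of phi over the class, so the Chernoff bound at theta gives the exponent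
   theta * (E_0 h + eps) + sup log phi. Let eps tend to 0 and optimise over theta. *)
theory Submission
  imports Defs
begin

text \<open>Only a first moment of \<open>h\<close> is available, so no variance of \<open>h\<close>
  can be used under H0: the weak law is obtained by truncation, and in L1 form, which Markov's
  inequality turns directly into a bound on the level. The two hypotheses live on unrelated
  probability spaces and communicate only through the real numbers \<open>\<gamma> n\<close>. Under
  H1 the laws are picked adaptively and \<open>\<mu>1\<close> is not assumed measurable in its
  argument, so the conditional step compares with a constant valid for the whole class instead of
  integrating the kernel. The order of limits is fixed: \<epsilon> tends to 0 for each \<theta>
  separately, and only then is the infimum over \<theta> taken. As that infimum may be -infinity, it
  is passed through the extended exponential by comparing lower bounds.\<close>

section \<open>Weak law of large numbers in L1 under a first moment\<close>

text \<open>Independence and centring kill the off-diagonal terms of the expanded square, so the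
  growth is linear in n instead of quadratic. The uniform bound \<open>B\<close> fits the intended
  use on truncated variables.\<close>

lemma (in prob_space) second_moment_sum_le:
  fixes Z :: "nat \<Rightarrow> 'a \<Rightarrow> real"
  assumes indep: "indep_vars (\<lambda>_. borel) Z {1..}"
    and bound: "\<And>t \<omega>. \<bar>Z t \<omega>\<bar> \<le> B"
    and centered: "\<And>t. t \<ge> 1 \<Longrightarrow> expectation (Z t) = 0"
  shows "integrable M (\<lambda>\<omega>. (\<Sum>t=1..n. Z t \<omega>)\<^sup>2)"
    and "expectation (\<lambda>\<omega>. (\<Sum>t=1..n. Z t \<omega>)\<^sup>2) \<le> real n * B\<^sup>2"
proof -
  have Z_meas: "Z t \<in> borel_measurable M" if "t \<ge> 1" for t
    using indep that by (auto simp: indep_vars_def)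
  have Z_int: "integrable M (Z t)" if "t \<ge> 1" for t
    by (rule integrable_const_bound[where B=B]) (use bound Z_meas that in auto)
  \<comment> \<open>The instance \<open>bound[of 0 \<omega>]\<close> serves to show that
    \<open>B\<close> is nonnegative.\<close>
  have prod_bound: "\<bar>Z s \<omega> * Z t \<omega>\<bar> \<le> B\<^sup>2" for s t \<omega>
    unfolding abs_mult power2_eq_square
    by (intro mult_mono bound) (use bound[of 0 \<omega>] in auto)
  have prod_int: "integrable M (\<lambda>\<omega>. Z s \<omega> * Z t \<omega>)" if "s \<ge> 1" "t \<ge> 1" for s t
    by (rule integrable_const_bound[where B="B\<^sup>2"])
      (use prod_bound Z_meas that in \<open>auto intro!: borel_measurable_times\<close>)
  have uncorrelated: "expectation (\<lambda>\<omega>. Z s \<omega> * Z t \<omega>) = 0" if "s \<ge> 1" "t \<ge> 1" "s \<noteq> t" for s t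
  proof -
    have "expectation (\<lambda>\<omega>. \<Prod>i\<in>{s, t}. Z i \<omega>) = (\<Prod>i\<in>{s, t}. expectation (Z i))"
      by (rule indep_vars_lebesgue_integral)
        (use that in \<open>auto intro!: indep_vars_subset[OF indep] Z_int\<close>)
    then show ?thesis
      using that by (simp add: centered)
  qed
  have square: "(\<Sum>t=1..n. Z t \<omega>)\<^sup>2 = (\<Sum>s=1..n. \<Sum>t=1..n. Z s \<omega> * Z t \<omega>)" for \<omega>
    by (simp add: power2_eq_square sum_product)
  show "integrable M (\<lambda>\<omega>. (\<Sum>t=1..n. Z t \<omega>)\<^sup>2)"
    unfolding square by (intro Bochner_Integration.integrable_sum prod_int) auto
  have "expectation (\<lambda>\<omega>. (\<Sum>t=1..n. Z t \<omega>)\<^sup>2)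
      = (\<Sum>s=1..n. expectation (\<lambda>\<omega>. \<Sum>t=1..n. Z s \<omega> * Z t \<omega>))"
    unfolding square
    by (intro Bochner_Integration.integral_sum Bochner_Integration.integrable_sum prod_int) auto
  also have "\<dots> = (\<Sum>s=1..n. \<Sum>t=1..n. expectation (\<lambda>\<omega>. Z s \<omega> * Z t \<omega>))"
    by (intro sum.cong refl Bochner_Integration.integral_sum prod_int) auto
  also have "\<dots> = (\<Sum>s=1..n. \<Sum>t=1..n. if s = t then expectation (\<lambda>\<omega>. Z s \<omega> * Z s \<omega>) else 0)"
    by (intro sum.cong refl) (auto simp: uncorrelated)
  also have "\<dots> = (\<Sum>s=1..n. expectation (\<lambda>\<omega>. Z s \<omega> * Z s \<omega>))"
    by (intro sum.cong refl) (auto simp: sum.delta')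
  also have "\<dots> \<le> (\<Sum>s=1..n. B\<^sup>2)"
  proof (rule sum_mono)
    fix s assume "s \<in> {1..n}"
    then have "expectation (\<lambda>\<omega>. Z s \<omega> * Z s \<omega>) \<le> expectation (\<lambda>\<omega>. B\<^sup>2)"
      by (intro integral_mono prod_int integrable_const) (use prod_bound \<open>s \<in> {1..n}\<close> in \<open>auto intro: abs_le_D1\<close>)
    then show "expectation (\<lambda>\<omega>. Z s \<omega> * Z s \<omega>) \<le> B\<^sup>2"
      by (simp add: prob_space)
  qed
  finally show "expectation (\<lambda>\<omega>. (\<Sum>t=1..n. Z t \<omega>)\<^sup>2) \<le> real n * B\<^sup>2"
    by simp
qed

text \<open>Dominated convergence with majorant |x|: at each fixed x the integrand is 0 as soon as k
  reaches |x|.\<close>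

lemma truncation_L1_convergence:
  fixes \<nu> :: "real measure"
  assumes "integrable \<nu> (\<lambda>x. x)"
  shows "(\<lambda>k. \<integral>x. \<bar>x - (if \<bar>x\<bar> \<le> real k then x else 0)\<bar> \<partial>\<nu>) \<longlonglongrightarrow> 0"
proof -
  have [measurable]: "(\<lambda>x. x) \<in> borel_measurable \<nu>"
    using assms by (rule borel_measurable_integrable)
  have "(\<lambda>k. \<integral>x. \<bar>x - (if \<bar>x\<bar> \<le> real k then x else 0)\<bar> \<partial>\<nu>) \<longlonglongrightarrow> (\<integral>x. 0 \<partial>\<nu>)"
  proof (rule integral_dominated_convergence[where w="\<lambda>x. \<bar>x\<bar>"])
    show "AE x in \<nu>. (\<lambda>k. \<bar>x - (if \<bar>x\<bar> \<le> real k then x else 0)\<bar>) \<longlonglongrightarrow> 0"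
    proof (rule AE_I2)
      fix x :: real
      have "\<forall>\<^sub>F k in sequentially. \<bar>x\<bar> \<le> real k"
        using eventually_ge_at_top[of "nat \<lceil>\<bar>x\<bar>\<rceil>"] by eventually_elim linarith
      then show "(\<lambda>k. \<bar>x - (if \<bar>x\<bar> \<le> real k then x else 0)\<bar>) \<longlonglongrightarrow> 0"
        by (intro tendsto_eventually, eventually_elim) simp
    qed
    show "integrable \<nu> (\<lambda>x. \<bar>x\<bar>)"
      using assms by (rule integrable_abs)
    show "(\<lambda>x. \<bar>x - (if \<bar>x\<bar> \<le> real k then x else 0)\<bar>) \<in> borel_measurable \<nu>" for k
      by measurable
  qed auto
  then show ?thesis by simp
qed

text \<open>Each variable splits into a bounded centred part, whose average is small in L2, and a
  tail whose L1 size is small by the choice of the truncation level k. That level is fixed before n,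
  so the variance term, of order k^2/n, still vanishes.\<close>

lemma (in prob_space) L1_weak_law_of_large_numbers:
  fixes X :: "nat \<Rightarrow> 'a \<Rightarrow> real"
  assumes indep: "indep_vars (\<lambda>_. borel) X {1..}"
    and distr: "\<And>t. t \<ge> 1 \<Longrightarrow> distr M borel (X t) = \<nu>"
    and int: "integrable \<nu> (\<lambda>x. x)"
  shows "(\<lambda>n. expectation (\<lambda>\<omega>. \<bar>(\<Sum>t=1..n. X t \<omega>) / n - (\<integral>x. x \<partial>\<nu>)\<bar>)) \<longlonglongrightarrow> 0"
proof -
  have X_meas: "X t \<in> borel_measurable M" if "t \<ge> 1" for t
    using indep that by (auto simp: indep_vars_def)
  have nu: "prob_space \<nu>" and sets_nu[measurable_cong]: "sets \<nu> = sets borel"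
    using distr[of 1] X_meas[of 1] by (auto intro: prob_space_distr)
  interpret \<nu>: prob_space \<nu> by (rule nu)
  have transfer_int: "integrable M (\<lambda>\<omega>. f (X t \<omega>))"
    and transfer: "expectation (\<lambda>\<omega>. f (X t \<omega>)) = (\<integral>x. f x \<partial>\<nu>)"
    if "t \<ge> 1" "integrable \<nu> f" for t and f :: "real \<Rightarrow> real"
  proof -
    have f: "f \<in> borel_measurable borel"
      using that(2) sets_nu by (metis borel_measurable_integrable measurable_cong_sets)
    show "integrable M (\<lambda>\<omega>. f (X t \<omega>))"
      using integrable_distr_eq[OF X_meas[OF that(1)] f] distr[OF that(1)] that(2) by simp
    show "expectation (\<lambda>\<omega>. f (X t \<omega>)) = (\<integral>x. f x \<partial>\<nu>)"
      using integral_distr[OF X_meas[OF that(1)] f] distr[OF that(1)] by simp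
  qed
  let ?m = "\<integral>x. x \<partial>\<nu>"
  have "\<exists>N. \<forall>n\<ge>N. norm (expectation (\<lambda>\<omega>. \<bar>(\<Sum>t=1..n. X t \<omega>) / n - ?m\<bar>) - 0) < e" if "e > 0" for e
  proof -
    \<comment> \<open>The budget for e: one \<eta> from \<open>amgm\<close>, two from the mean of
      \<open>r\<close>, and one from the variance term once n is large.\<close>
    define \<eta> where "\<eta> = e / 4"
    have \<eta>: "\<eta> > 0" using that by (simp add: \<eta>_def)
    have "\<forall>\<^sub>F k in sequentially. (\<integral>x. \<bar>x - (if \<bar>x\<bar> \<le> real k then x else 0)\<bar> \<partial>\<nu>) < \<eta>"
      using order_tendstoD(2)[OF truncation_L1_convergence[OF int] \<eta>] .
    then obtain k where k: "(\<integral>x. \<bar>x - (if \<bar>x\<bar> \<le> real k then x else 0)\<bar> \<partial>\<nu>) < \<eta>"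
      by (meson eventually_happens' sequentially_bot)
    define g where "g x = (if \<bar>x\<bar> \<le> real k then x else 0)" for x :: real
    have g_meas[measurable]: "g \<in> borel_measurable borel"
      unfolding g_def by measurable
    have g_bound: "\<bar>g x\<bar> \<le> k" for x by (simp add: g_def)
    have g_int: "integrable \<nu> g"
      by (rule \<nu>.integrable_const_bound[where B=k]) (use g_bound in auto)
    define a where "a = (\<integral>x. g x \<partial>\<nu>)"
    have a_bound: "\<bar>a\<bar> \<le> k"
    proof -
      have "\<bar>a\<bar> \<le> (\<integral>x. \<bar>g x\<bar> \<partial>\<nu>)"
        unfolding a_def using integral_norm_bound[of \<nu> g] by simp
      also have "\<dots> \<le> (\<integral>x. real k \<partial>\<nu>)"
        by (intro integral_mono integrable_abs g_int) (use g_bound in auto)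
      finally show ?thesis by (simp add: \<nu>.prob_space)
    qed
    have diff: "(\<integral>x. \<bar>x - g x\<bar> \<partial>\<nu>) < \<eta>" using k by (simp add: g_def)
    have "\<bar>?m - a\<bar> \<le> (\<integral>x. \<bar>x - g x\<bar> \<partial>\<nu>)"
      using integral_norm_bound[of \<nu> "\<lambda>x. x - g x"] int g_int by (simp add: a_def)
    then have mean_diff: "\<bar>?m - a\<bar> < \<eta>" using diff by simp
    define Z where "Z t \<omega> = g (X t \<omega>) - a" for t \<omega>
    have Z_indep: "indep_vars (\<lambda>_. borel) Z {1..}"
      unfolding Z_def[abs_def]
      by (rule indep_vars_compose2[where Y="\<lambda>_ x. g x - a", OF indep]) simp
    have Z_bound: "\<bar>Z t \<omega>\<bar> \<le> 2 * k" for t \<omega>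
      using g_bound[of "X t \<omega>"] a_bound unfolding Z_def by linarith
    have Z_mean: "expectation (Z t) = 0" if "t \<ge> 1" for t
      unfolding Z_def using transfer[OF that g_int] transfer_int[OF that g_int]
      by (simp add: a_def prob_space)
    note Z2 = second_moment_sum_le[OF Z_indep Z_bound Z_mean]
    \<comment> \<open>Dominates |(x - m) - (g x - a)|, the error of replacing the centred variable
      by its centred truncation, where m is the mean of \<nu>. Each of the two summands contributes
      less than \<eta> to the mean.\<close>
    define r where "r x = \<bar>x - g x\<bar> + \<bar>?m - a\<bar>" for x
    have r_int: "integrable \<nu> r"
      unfolding r_def using int g_int by auto
    have r_mean: "(\<integral>x. r x \<partial>\<nu>) \<le> 2 * \<eta>"
      unfolding r_def using int g_int diff mean_diff by (simp add: \<nu>.prob_space)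
    \<comment> \<open>Trades an absolute value for a square at the price of an additive \<eta>, so
      that the second moment bound applies to the average of the \<open>Z t\<close>.\<close>
    have amgm: "\<bar>w\<bar> \<le> w\<^sup>2 / \<eta> + \<eta>" for w :: real
    proof -
      have "0 \<le> (\<bar>w\<bar> - \<eta>)\<^sup>2 + \<eta> * \<bar>w\<bar>" using \<eta> by simp
      also have "\<dots> = w\<^sup>2 + \<eta> * \<eta> - \<bar>w\<bar> * \<eta>" by (simp add: power2_eq_square algebra_simps)
      finally show ?thesis using \<eta> by (simp add: field_simps power2_eq_square)
    qed
    have estimate: "expectation (\<lambda>\<omega>. \<bar>(\<Sum>t=1..n. X t \<omega>) / n - ?m\<bar>)
        \<le> (2 * k)\<^sup>2 / (n * \<eta>) + 3 * \<eta>" if n: "n \<ge> 1" for n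
    proof -
      have pointwise: "\<bar>(\<Sum>t=1..n. X t \<omega>) / n - ?m\<bar>
          \<le> (\<Sum>t=1..n. Z t \<omega>)\<^sup>2 / (n\<^sup>2 * \<eta>) + \<eta> + (\<Sum>t=1..n. r (X t \<omega>)) / n" for \<omega>
      proof -
        let ?W = "(\<Sum>t=1..n. Z t \<omega>) / n"
        have "(\<Sum>t=1..n. X t \<omega>) / n - ?m = (\<Sum>t=1..n. X t \<omega> - ?m) / n"
          using n by (simp add: sum_subtractf field_simps)
        also have "\<dots> = ?W + (\<Sum>t=1..n. X t \<omega> - g (X t \<omega>) - (?m - a)) / n"
          by (simp add: Z_def add_divide_distrib[symmetric] sum.distrib[symmetric] algebra_simps)
        finally have decomposition: "(\<Sum>t=1..n. X t \<omega>) / n - ?m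
            = ?W + (\<Sum>t=1..n. X t \<omega> - g (X t \<omega>) - (?m - a)) / n" .
        have "\<bar>(\<Sum>t=1..n. X t \<omega>) / n - ?m\<bar>
            \<le> \<bar>?W\<bar> + \<bar>\<Sum>t=1..n. X t \<omega> - g (X t \<omega>) - (?m - a)\<bar> / n"
          unfolding decomposition by (rule order_trans[OF abs_triangle_ineq]) (simp add: abs_divide)
        also have "\<bar>\<Sum>t=1..n. X t \<omega> - g (X t \<omega>) - (?m - a)\<bar> \<le> (\<Sum>t=1..n. r (X t \<omega>))"
          unfolding r_def by (rule order_trans[OF sum_abs]) (intro sum_mono abs_triangle_ineq4)
        also have "\<bar>?W\<bar> \<le> ?W\<^sup>2 / \<eta> + \<eta>"
          by (rule amgm)
        also have "?W\<^sup>2 / \<eta> = (\<Sum>t=1..n. Z t \<omega>)\<^sup>2 / (n\<^sup>2 * \<eta>)"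
          by (simp add: power_divide)
        finally show ?thesis by (simp add: divide_right_mono)
      qed
      have sum_int: "integrable M (\<lambda>\<omega>. \<Sum>t=1..n. r (X t \<omega>))"
        by (intro Bochner_Integration.integrable_sum transfer_int r_int) auto
      have "expectation (\<lambda>\<omega>. \<bar>(\<Sum>t=1..n. X t \<omega>) / n - ?m\<bar>)
          \<le> expectation (\<lambda>\<omega>. (\<Sum>t=1..n. Z t \<omega>)\<^sup>2 / (n\<^sup>2 * \<eta>) + \<eta> + (\<Sum>t=1..n. r (X t \<omega>)) / n)"
      proof (rule integral_mono)
        show "integrable M (\<lambda>\<omega>. \<bar>(\<Sum>t=1..n. X t \<omega>) / n - ?m\<bar>)"
          by (intro integrable_abs Bochner_Integration.integrable_diff integrable_divide
              Bochner_Integration.integrable_sum transfer_int[OF _ int]) auto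
        show "integrable M (\<lambda>\<omega>. (\<Sum>t=1..n. Z t \<omega>)\<^sup>2 / (n\<^sup>2 * \<eta>) + \<eta> + (\<Sum>t=1..n. r (X t \<omega>)) / n)"
          using Z2(1) sum_int by (intro Bochner_Integration.integrable_add integrable_divide) auto
      qed (rule pointwise)
      also have "\<dots> = expectation (\<lambda>\<omega>. (\<Sum>t=1..n. Z t \<omega>)\<^sup>2) / (n\<^sup>2 * \<eta>) + \<eta>
          + expectation (\<lambda>\<omega>. \<Sum>t=1..n. r (X t \<omega>)) / n"
        using Z2(1) sum_int by (simp add: prob_space)
      also have "expectation (\<lambda>\<omega>. \<Sum>t=1..n. r (X t \<omega>)) = n * (\<integral>x. r x \<partial>\<nu>)"
        by (subst Bochner_Integration.integral_sum) (auto simp: transfer[OF _ r_int] transfer_int[OF _ r_int])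
      also have "expectation (\<lambda>\<omega>. (\<Sum>t=1..n. Z t \<omega>)\<^sup>2) / (n\<^sup>2 * \<eta>) \<le> n * (2 * k)\<^sup>2 / (n\<^sup>2 * \<eta>)"
        using Z2(2)[of n] \<eta> by (intro divide_right_mono) auto
      also have "n * (2 * k)\<^sup>2 / (n\<^sup>2 * \<eta>) = (2 * k)\<^sup>2 / (n * \<eta>)"
        using n by (simp add: power2_eq_square)
      finally show ?thesis using r_mean n by simp
    qed
    have "(\<lambda>n. (2 * real k)\<^sup>2 / (real n * \<eta>)) \<longlonglongrightarrow> 0"
      using tendsto_mult_right[OF lim_1_over_n, of "(2 * real k)\<^sup>2 / \<eta>"] by (simp add: field_simps)
    then have "\<forall>\<^sub>F n in sequentially. (2 * real k)\<^sup>2 / (real n * \<eta>) < \<eta>"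
      using \<eta> by (rule order_tendstoD(2))
    then have "\<forall>\<^sub>F n in sequentially. norm (expectation (\<lambda>\<omega>. \<bar>(\<Sum>t=1..n. X t \<omega>) / n - ?m\<bar>) - 0) < e"
      using eventually_ge_at_top[of 1]
    proof eventually_elim
      case (elim n)
      have "0 \<le> expectation (\<lambda>\<omega>. \<bar>(\<Sum>t=1..n. X t \<omega>) / n - ?m\<bar>)" by simp
      then show ?case using estimate[OF elim(2)] elim(1) by (simp add: \<eta>_def)
    qed
    then show ?thesis by (simp add: eventually_sequentially)
  qed
  then show ?thesis by (intro LIMSEQ_I) auto
qed

section \<open>Integration against a conditional law\<close>

text \<open>As \<open>\<omega> \<mapsto> \<kappa> \<omega> A\<close> need not be \<open>M\<close>-measurable, integrals of \<open>\<kappa>\<close> against \<open>M\<close> are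
  avoided: \<open>g\<close> is approximated by simple functions, and conditional probabilities of the
  finitely many level sets are bounded almost surely.\<close>

lemma conditional_law_nn_integral_le:
  fixes Z :: "'b \<Rightarrow> ennreal" and g :: "'y \<Rightarrow> ennreal" and C :: ennreal
  assumes M: "prob_space M" and G: "subalgebra M G"
    and X[measurable]: "X \<in> measurable M S"
    and law: "conditional_law M G S X \<kappa>"
    and kernel: "AE \<omega> in M. prob_measure_on S (\<kappa> \<omega>)"
    and Z[measurable]: "Z \<in> borel_measurable G" and g[measurable]: "g \<in> borel_measurable S"
    and bound: "AE \<omega> in M. (\<integral>\<^sup>+ y. g y \<partial>\<kappa> \<omega>) \<le> C"
  shows "(\<integral>\<^sup>+ \<omega>. Z \<omega> * g (X \<omega>) \<partial>M) \<le> C * (\<integral>\<^sup>+ \<omega>. Z \<omega> \<partial>M)"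
proof -
  interpret prob_space M by fact
  interpret finite_measure_subalgebra M G by standard (rule G)
  have Z'[measurable]: "Z \<in> borel_measurable M"
    by (rule measurable_from_subalg[OF G Z])
  have event: "(\<integral>\<^sup>+ \<omega>. Z \<omega> * indicator A (X \<omega>) \<partial>M)
      = (\<integral>\<^sup>+ \<omega>. Z \<omega> * ennreal (real_cond_exp M G (\<lambda>\<omega>. indicator A (X \<omega>)) \<omega>) \<partial>M)"
    if A[measurable]: "A \<in> sets S" for A
  proof -
    let ?f = "\<lambda>\<omega>. indicator A (X \<omega>) :: ennreal"
    \<comment> \<open>\<open>real_cond_exp\<close> is the difference of \<open>enn2real\<close> of
      the conditional expectations of the positive and negative parts. As \<open>enn2real\<close>
      sends infinity to 0, almost sure finiteness is needed to recover \<open>nn_cond_exp\<close>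
      from it; the negative part is 0.\<close>
    have "(\<integral>\<^sup>+ \<omega>. 1 * nn_cond_exp M G ?f \<omega> \<partial>M) = (\<integral>\<^sup>+ \<omega>. 1 * ?f \<omega> \<partial>M)"
      by (rule nn_cond_exp_intg) auto
    also have "\<dots> \<le> (\<integral>\<^sup>+ \<omega>. 1 \<partial>M)"
      by (intro nn_integral_mono) (auto simp: indicator_def)
    finally have "(\<integral>\<^sup>+ \<omega>. nn_cond_exp M G ?f \<omega> \<partial>M) \<noteq> \<infinity>"
      by (auto simp: emeasure_space_1 top_unique)
    then have fin: "AE \<omega> in M. nn_cond_exp M G ?f \<omega> \<noteq> \<infinity>"
      by (intro nn_integral_noteq_infinite) auto
    have zero: "AE \<omega> in M. 0 = nn_cond_exp M G (\<lambda>_. 0) \<omega>"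
      by (rule nn_cond_exp_F_meas) simp
    have neg: "(\<lambda>\<omega>. ennreal (- indicator A (X \<omega>))) = (\<lambda>_. 0)"
      by (auto simp: ennreal_neg)
    have "(\<integral>\<^sup>+ \<omega>. Z \<omega> * ?f \<omega> \<partial>M) = (\<integral>\<^sup>+ \<omega>. Z \<omega> * nn_cond_exp M G ?f \<omega> \<partial>M)"
      by (rule nn_cond_exp_intg[symmetric]) auto
    also have "\<dots> = (\<integral>\<^sup>+ \<omega>. Z \<omega> * ennreal (real_cond_exp M G (\<lambda>\<omega>. indicator A (X \<omega>)) \<omega>) \<partial>M)"
      using fin zero
      by (intro nn_integral_cong_AE, eventually_elim)
        (simp add: real_cond_exp_def neg ennreal_indicator less_top)
    finally show ?thesis .
  qed
  have simple: "(\<integral>\<^sup>+ \<omega>. Z \<omega> * u (X \<omega>) \<partial>M) \<le> C * (\<integral>\<^sup>+ \<omega>. Z \<omega> \<partial>M)"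
    if u: "simple_function S u" and le: "\<And>y. u y \<le> g y" for u
  proof -
    define A where "A c = u -` {c} \<inter> space S" for c
    define I where "I = u ` space S"
    have A[measurable]: "A c \<in> sets S" for c
      unfolding A_def using u by (rule simple_functionD)
    have finI: "finite I"
      unfolding I_def using u by (rule simple_functionD)
    have rep: "u y = (\<Sum>c\<in>I. c * indicator (A c) y)" if "y \<in> space S" for y
      unfolding A_def I_def by (rule simple_function_indicator_representation[OF u that])
    let ?p = "\<lambda>c \<omega>. real_cond_exp M G (\<lambda>\<omega>. indicator (A c) (X \<omega>)) \<omega>"
    have "(\<integral>\<^sup>+ \<omega>. Z \<omega> * u (X \<omega>) \<partial>M) = (\<integral>\<^sup>+ \<omega>. (\<Sum>c\<in>I. c * (Z \<omega> * indicator (A c) (X \<omega>))) \<partial>M)"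
      by (intro nn_integral_cong)
        (use measurable_space[OF X] in \<open>simp add: rep sum_distrib_left mult_ac\<close>)
    also have "\<dots> = (\<Sum>c\<in>I. c * (\<integral>\<^sup>+ \<omega>. Z \<omega> * indicator (A c) (X \<omega>) \<partial>M))"
      by (simp add: nn_integral_sum nn_integral_cmult)
    also have "\<dots> = (\<Sum>c\<in>I. c * (\<integral>\<^sup>+ \<omega>. Z \<omega> * ennreal (?p c \<omega>) \<partial>M))"
      by (simp add: event)
    also have "\<dots> = (\<integral>\<^sup>+ \<omega>. (\<Sum>c\<in>I. c * (Z \<omega> * ennreal (?p c \<omega>))) \<partial>M)"
      by (simp add: nn_integral_sum nn_integral_cmult)
    also have "\<dots> \<le> (\<integral>\<^sup>+ \<omega>. C * Z \<omega> \<partial>M)"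
    proof (rule nn_integral_mono_AE)
      \<comment> \<open>The identity holds for each event off a null set of its own; finitely many
        levels keep the union of these sets null.\<close>
      have "AE \<omega> in M. \<forall>c\<in>I. ?p c \<omega> = measure (\<kappa> \<omega>) (A c)"
        using law finI by (intro AE_finite_allI) (auto simp: conditional_law_def)
      with kernel bound
      show "AE \<omega> in M. (\<Sum>c\<in>I. c * (Z \<omega> * ennreal (?p c \<omega>))) \<le> C * Z \<omega>"
      proof eventually_elim
        case (elim \<omega>)
        interpret \<kappa>: prob_space "\<kappa> \<omega>" using elim by (simp add: prob_measure_on_def)
        have sets: "sets (\<kappa> \<omega>) = sets S" using elim by (simp add: prob_measure_on_def)
        note space = sets_eq_imp_space_eq[OF sets]
        have A': "A c \<in> sets (\<kappa> \<omega>)" for c by (simp add: sets A)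
        have "(\<Sum>c\<in>I. c * (Z \<omega> * ennreal (?p c \<omega>))) = (\<Sum>c\<in>I. c * emeasure (\<kappa> \<omega>) (A c)) * Z \<omega>"
          using elim by (simp add: sum_distrib_left sum_distrib_right \<kappa>.emeasure_eq_measure mult_ac)
        also have "(\<Sum>c\<in>I. c * emeasure (\<kappa> \<omega>) (A c)) = (\<integral>\<^sup>+ y. (\<Sum>c\<in>I. c * indicator (A c) y) \<partial>\<kappa> \<omega>)"
          using A' by (simp add: nn_integral_sum nn_integral_cmult_indicator)
        also have "\<dots> = (\<integral>\<^sup>+ y. u y \<partial>\<kappa> \<omega>)"
          by (intro nn_integral_cong) (simp add: rep space)
        also have "\<dots> \<le> (\<integral>\<^sup>+ y. g y \<partial>\<kappa> \<omega>)"
          by (intro nn_integral_mono le)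
        \<comment> \<open>This is the hypothesis \<open>bound\<close> at the given \<omega>, where
          \<open>C\<close> enters.\<close>
        also note elim(2)
        finally show ?case by (simp add: mult_right_mono)
      qed
    qed
    also have "\<dots> = C * (\<integral>\<^sup>+ \<omega>. Z \<omega> \<partial>M)" by (simp add: nn_integral_cmult)
    finally show ?thesis .
  qed
  obtain u where u: "\<And>i. simple_function S (u i)" "incseq u" "\<And>y. (SUP i. u i y) = g y"
    using borel_measurable_implies_simple_function_sequence'[OF g] by metis
  have [measurable]: "u i \<in> borel_measurable S" for i
    by (rule borel_measurable_simple_function[OF u(1)])
  have "(\<integral>\<^sup>+ \<omega>. Z \<omega> * g (X \<omega>) \<partial>M) = (\<integral>\<^sup>+ \<omega>. (SUP i. Z \<omega> * u i (X \<omega>)) \<partial>M)"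
    by (simp add: SUP_mult_left_ennreal[symmetric] u(3))
  also have "\<dots> = (SUP i. \<integral>\<^sup>+ \<omega>. Z \<omega> * u i (X \<omega>) \<partial>M)"
    using u(2) by (intro nn_integral_monotone_convergence_SUP)
      (auto simp: incseq_def le_fun_def intro!: mult_left_mono)
  also have "\<dots> \<le> C * (\<integral>\<^sup>+ \<omega>. Z \<omega> \<partial>M)"
    by (intro SUP_least simple u(1)) (auto simp: u(3)[symmetric] intro: SUP_upper)
  finally show ?thesis .
qed

section \<open>The threshold under H0\<close>

text \<open>Raising the threshold can only increase the Type II error, so an upper bound on
  \<open>\<gamma> n\<close> is what the analysis under H1 requires.\<close>

lemma threshold_eventually_le:
  fixes h :: "'y \<Rightarrow> real"
  assumes H0: "H0_model S \<mu>0 M Y"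
    and h[measurable]: "h \<in> borel_measurable S"
    and int: "integrable \<mu>0 h"
    and "0 < \<alpha>" "0 < \<epsilon>"
    and level: "\<And>n. n \<ge> 1 \<Longrightarrow>
      measure M {\<omega> \<in> space M. detection_rule h (\<gamma> n) n (\<lambda>t. Y t \<omega>) = 1} = \<alpha>"
  shows "\<forall>\<^sub>F n in sequentially. \<gamma> n \<le> real n * ((\<integral>y. h y \<partial>\<mu>0) + \<epsilon>)"
proof -
  interpret prob_space M using H0 by (simp add: H0_model_def)
  have indep: "indep_vars (\<lambda>_. S) Y {1..}" and law: "\<And>t. t \<ge> 1 \<Longrightarrow> distr M S (Y t) = \<mu>0"
    using H0 by (auto simp: H0_model_def)
  have Y: "Y t \<in> measurable M S" if "t \<ge> 1" for t
    using indep that by (auto simp: indep_vars_def)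
  have h0[measurable]: "h \<in> borel_measurable \<mu>0"
    using int by (rule borel_measurable_integrable)
  let ?m = "\<integral>y. h y \<partial>\<mu>0"
  let ?D = "\<lambda>n \<omega>. \<bar>(\<Sum>t=1..n. h (Y t \<omega>)) / n - ?m\<bar>"
  \<comment> \<open>The weak law is applied to the scores, whose common law is the image of
    \<open>\<mu>0\<close> under \<open>h\<close>; a change of variables then turns the mean into E_0
    h.\<close>
  have "(\<lambda>n. expectation (\<lambda>\<omega>. \<bar>(\<Sum>t=1..n. h (Y t \<omega>)) / n - (\<integral>x. x \<partial>distr \<mu>0 borel h)\<bar>)) \<longlonglongrightarrow> 0"
  proof (rule L1_weak_law_of_large_numbers)
    show "indep_vars (\<lambda>_. borel) (\<lambda>t \<omega>. h (Y t \<omega>)) {1..}"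
      by (rule indep_vars_compose2[where Y="\<lambda>_. h", OF indep]) simp
    show "distr M borel (\<lambda>\<omega>. h (Y t \<omega>)) = distr \<mu>0 borel h" if "t \<ge> 1" for t
      using distr_distr[OF h Y[OF that]] law[OF that] by (simp add: comp_def)
    show "integrable (distr \<mu>0 borel h) (\<lambda>x. x)"
      using int by (simp add: integrable_distr_eq)
  qed
  then have "(\<lambda>n. expectation (?D n)) \<longlonglongrightarrow> 0"
    by (simp add: integral_distr)
  \<comment> \<open>Markov's inequality at height \<epsilon> divides by \<epsilon>, so this target
    pushes the rejection probability strictly below \<alpha>.\<close>
  then have "\<forall>\<^sub>F n in sequentially. expectation (?D n) < \<alpha> * \<epsilon>"
    using assms by (intro order_tendstoD(2)) auto
  then show ?thesis
    using eventually_ge_at_top[of 1]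
  proof eventually_elim
    case (elim n)
    have D_int: "integrable M (?D n)"
    proof (intro integrable_abs Bochner_Integration.integrable_diff integrable_divide
        Bochner_Integration.integrable_sum integrable_const)
      fix t assume "t \<in> {1..n}"
      then have "t \<ge> 1" by simp
      then show "integrable M (\<lambda>\<omega>. h (Y t \<omega>))"
        using integrable_distr_eq[OF Y h] law int by simp
    qed
    show ?case
    proof (rule ccontr)
      assume "\<not> \<gamma> n \<le> real n * (?m + \<epsilon>)"
      then have large: "real n * (?m + \<epsilon>) < \<gamma> n" by simp
      have sub: "{\<omega> \<in> space M. detection_rule h (\<gamma> n) n (\<lambda>t. Y t \<omega>) = 1} \<subseteq> {\<omega> \<in> space M. \<epsilon> \<le> ?D n \<omega>}"
      proof (rule subsetI, unfold mem_Collect_eq, elim conjE, rule conjI)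
        fix \<omega> assume rule1: "detection_rule h (\<gamma> n) n (\<lambda>t. Y t \<omega>) = 1"
        have "\<gamma> n \<le> (\<Sum>t=1..n. h (Y t \<omega>))"
        proof (rule ccontr)
          assume "\<not> ?thesis"
          then show False using rule1 unfolding detection_rule_def by simp
        qed
        with large have "real n * (?m + \<epsilon>) \<le> (\<Sum>t=1..n. h (Y t \<omega>))" by linarith
        then have "?m + \<epsilon> \<le> (\<Sum>t=1..n. h (Y t \<omega>)) / n"
          using elim(2) by (simp add: pos_le_divide_eq mult.commute)
        then show "\<epsilon> \<le> ?D n \<omega>" by linarith
      qed
      have [measurable]: "?D n \<in> borel_measurable M"
        using D_int by (rule borel_measurable_integrable)
      have "\<alpha> = prob {\<omega> \<in> space M. detection_rule h (\<gamma> n) n (\<lambda>t. Y t \<omega>) = 1}"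
        using level[OF elim(2)] by (rule sym)
      also have "\<dots> \<le> prob {\<omega> \<in> space M. \<epsilon> \<le> ?D n \<omega>}"
        by (rule finite_measure_mono[OF sub]) measurable
      also have "\<dots> \<le> expectation (?D n) / \<epsilon>"
        by (rule integral_Markov_inequality_measure[where A="{}"]) (use D_int \<open>0 < \<epsilon>\<close> in auto)
      finally show False
        using elim(1) \<open>0 < \<epsilon>\<close> by (simp add: pos_le_divide_eq)
    qed
  qed
qed

section \<open>Exponential moments under H1\<close>

text \<open>The observations are dependent, so the expectation of the product does not factor. A
  bound on \<open>phi\<close> uniform over the class holds whatever law the past selects, and each
  step costs one factor \<open>C\<close>. Working in \<open>ennreal\<close> avoids asking for
  integrability of the exponential.\<close>

lemma H1_laplace_transform_le:
  fixes P :: "nat \<Rightarrow> 'b \<Rightarrow> real ^ 'w::finite"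
  assumes H1: "H1_model S \<mu>1 M F P Y"
    and mu1: "\<And>p. p \<in> ntp_distributions \<Longrightarrow> prob_measure_on S (\<mu>1 p)"
    and P_in_class: "\<And>t. t \<ge> 1 \<Longrightarrow> AE \<omega> in M. P t \<omega> \<in> \<P>"
    and h[measurable]: "h \<in> borel_measurable S"
    and phi_le: "\<And>p. p \<in> \<P> \<Longrightarrow> phi h (\<mu>1 p) \<theta> \<le> C"
  shows "(\<integral>\<^sup>+ \<omega>. ennreal (exp (- \<theta> * (\<Sum>t=1..n. h (Y t \<omega>)))) \<partial>M) \<le> C ^ n"
proof -
  interpret prob_space M using H1 by (simp add: H1_model_def)
  have filt: "filtration (space M) F" and sub: "\<And>t. subalgebra M (F t)"
    and Y: "\<And>t. t \<ge> 1 \<Longrightarrow> Y t \<in> measurable (F t) S"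
    and ntp: "\<And>t \<omega>. t \<ge> 1 \<Longrightarrow> \<omega> \<in> space M \<Longrightarrow> P t \<omega> \<in> ntp_distributions"
    and law: "\<And>t. t \<ge> 1 \<Longrightarrow> conditional_law M (F (t - 1)) S (Y t) (\<lambda>\<omega>. \<mu>1 (P t \<omega>))"
    using H1 by (auto simp: H1_model_def)
  have subF: "subalgebra (F n) (F t)" if "t \<le> n" for t n
    using that filtration.space_F[OF filt] filtration.sets_F_mono[OF filt]
    by (simp add: subalgebra_def)
  show ?thesis
  proof (induction n)
    case 0
    show ?case by (simp add: emeasure_space_1)
  next
    case (Suc n)
    let ?Z = "\<lambda>\<omega>. ennreal (exp (- \<theta> * (\<Sum>t=1..n. h (Y t \<omega>))))"
    have "(\<integral>\<^sup>+ \<omega>. ennreal (exp (- \<theta> * (\<Sum>t=1..Suc n. h (Y t \<omega>)))) \<partial>M)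
        = (\<integral>\<^sup>+ \<omega>. ?Z \<omega> * ennreal (exp (- \<theta> * h (Y (Suc n) \<omega>))) \<partial>M)"
      by (simp add: ennreal_mult' [symmetric] exp_add[symmetric] algebra_simps)
    also have "\<dots> \<le> C * (\<integral>\<^sup>+ \<omega>. ?Z \<omega> \<partial>M)"
    proof (rule conditional_law_nn_integral_le[where S=S and g="\<lambda>y. ennreal (exp (- \<theta> * h y))"])
      show "prob_space M" by (rule prob_space_axioms)
      \<comment> \<open>The past at time t = \<open>Suc n\<close> is \<open>F (t - 1)\<close>, that
        is \<open>F n\<close>, and the first n scores are measurable with respect to it.\<close>
      show "subalgebra M (F n)" by (rule sub)
      show "Y (Suc n) \<in> measurable M S"
        by (rule measurable_from_subalg[OF sub Y]) simp
      show "conditional_law M (F n) S (Y (Suc n)) (\<lambda>\<omega>. \<mu>1 (P (Suc n) \<omega>))"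
        using law[of "Suc n"] by simp
      show "AE \<omega> in M. prob_measure_on S (\<mu>1 (P (Suc n) \<omega>))"
        by (intro AE_I2 mu1 ntp) auto
      have [measurable]: "Y t \<in> measurable (F n) S" if "t \<in> {1..n}" for t
        using that by (intro measurable_from_subalg[OF subF Y]) auto
      show "?Z \<in> borel_measurable (F n)" by measurable
      show "(\<lambda>y. ennreal (exp (- \<theta> * h y))) \<in> borel_measurable S" by measurable
      show "AE \<omega> in M. (\<integral>\<^sup>+ y. ennreal (exp (- \<theta> * h y)) \<partial>\<mu>1 (P (Suc n) \<omega>)) \<le> C"
        using P_in_class[of "Suc n"] phi_le by (auto simp: phi_def elim: eventually_mono)
    qed
    also have "\<dots> \<le> C * C ^ n"
      by (intro mult_left_mono Suc.IH) simp
    finally show ?case by simp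
  qed
qed

section \<open>Extended logarithm and exponential\<close>

text \<open>Excludes the value -infinity of \<open>ext_log\<close> on the class: a function that is
  positive everywhere has a positive integral over a probability measure.\<close>

lemma phi_pos:
  assumes "prob_measure_on S \<nu>" "h \<in> borel_measurable S"
  shows "0 < phi h \<nu> \<theta>"
proof -
  interpret prob_space \<nu> using assms by (simp add: prob_measure_on_def)
  have [measurable_cong]: "sets \<nu> = sets S" using assms by (simp add: prob_measure_on_def)
  note [measurable] = assms(2)
  have "phi h \<nu> \<theta> \<noteq> 0"
    unfolding phi_def by (subst nn_integral_0_iff_AE) (auto simp: ennreal_eq_0_iff not_le AE_False)
  then show ?thesis by (simp add: zero_less_iff_neq_zero)
qed

lemma ext_log_le_imp:
  assumes "ext_log x \<le> ereal s"
  shows "x \<le> ennreal (exp s)"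
proof (cases x)
  case (real r)
  show ?thesis
  proof (cases "r = 0")
    case False
    with real assms have "ln r \<le> s" "r > 0" by (auto simp: ext_log_def)
    then have "r \<le> exp s" by (metis exp_le_cancel_iff exp_ln)
    then show ?thesis using real by (simp add: ennreal_leI)
  qed (use real in simp)
next
  case top
  with assms show ?thesis by (simp add: ext_log_def)
qed

text \<open>For real r > 0, r \<le> \<open>ext_exp z\<close> holds exactly when ln r \<le> z, so a
  lower bound can be moved into the exponent, where it passes to the infimum. The cases L \<le> 0
  and L = infinity, which have no real logarithm, are settled apart.\<close>

lemma le_ext_exp_INF:
  fixes f :: "'i \<Rightarrow> ereal"
  assumes "\<And>i. i \<in> I \<Longrightarrow> L \<le> ext_exp (f i)"
  shows "L \<le> ext_exp (INF i\<in>I. f i)"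
proof (cases "L \<le> 0")
  case True
  moreover have "0 \<le> ext_exp z" for z
    by (cases z) (auto simp: ext_exp_def)
  ultimately show ?thesis by (rule order_trans)
next
  case False
  have le_iff: "ereal r \<le> ext_exp z \<longleftrightarrow> ereal (ln r) \<le> z" if "r > 0" for r z
  proof -
    have "r \<le> exp x \<longleftrightarrow> ln r \<le> x" for x
      using that by (metis exp_le_cancel_iff exp_ln)
    then show ?thesis
      using that by (cases z) (auto simp: ext_exp_def)
  qed
  show ?thesis
  proof (cases L)
    case (real r)
    with False have "r > 0" by simp
    then have "ereal (ln r) \<le> (INF i\<in>I. f i)"
      using assms real by (intro INF_greatest) (simp add: le_iff)
    then show ?thesis using real \<open>r > 0\<close> by (simp add: le_iff)
  next
    case PInf
    have "f i = \<infinity>" if "i \<in> I" for i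
      using assms[OF that] PInf by (cases "f i") (auto simp: ext_exp_def)
    then have "(INF i\<in>I. f i) = \<infinity>"
      by (simp add: top_ereal_def[symmetric] cong: INF_cong)
    then show ?thesis by (simp add: ext_exp_def)
  qed (use False in simp)
qed

section \<open>Chernoff bound and error exponent\<close>

text \<open>Since \<theta> \<ge> 0, the exponential of \<theta> times (c minus the total score) is
  at least 1 wherever the rule returns 0. The threshold is left free, so that the estimate from H0
  can be inserted afterwards.\<close>

lemma type_II_error_le:
  fixes P :: "nat \<Rightarrow> 'b \<Rightarrow> real ^ 'w::finite"
  assumes H1: "H1_model S \<mu>1 M F P Y"
    and mu1: "\<And>p. p \<in> ntp_distributions \<Longrightarrow> prob_measure_on S (\<mu>1 p)"
    and P_in_class: "\<And>t. t \<ge> 1 \<Longrightarrow> AE \<omega> in M. P t \<omega> \<in> \<P>"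
    and h[measurable]: "h \<in> borel_measurable S"
    and phi_le: "\<And>p. p \<in> \<P> \<Longrightarrow> phi h (\<mu>1 p) \<theta> \<le> ennreal (exp s)"
    and "0 \<le> \<theta>"
  shows "measure M {\<omega> \<in> space M. detection_rule h c n (\<lambda>t. Y t \<omega>) = 0} \<le> exp (\<theta> * c + real n * s)"
proof -
  interpret prob_space M using H1 by (simp add: H1_model_def)
  have [measurable]: "Y t \<in> measurable M S" if "t \<in> {1..n}" for t
    using H1 that by (intro measurable_from_subalg[of M "F t"]) (auto simp: H1_model_def)
  let ?E = "{\<omega> \<in> space M. detection_rule h c n (\<lambda>t. Y t \<omega>) = 0}"
  have E_eq: "?E = {\<omega> \<in> space M. (\<Sum>t=1..n. h (Y t \<omega>)) < c}"
    by (auto simp: detection_rule_def split: if_splits)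
  have E[measurable]: "?E \<in> events"
    unfolding E_eq by measurable
  have "emeasure M ?E = (\<integral>\<^sup>+ \<omega>. indicator ?E \<omega> \<partial>M)"
    by simp
  also have "\<dots> \<le> (\<integral>\<^sup>+ \<omega>. ennreal (exp (\<theta> * c)) * ennreal (exp (- \<theta> * (\<Sum>t=1..n. h (Y t \<omega>)))) \<partial>M)"
  proof (rule nn_integral_mono)
    fix \<omega>
    show "indicator ?E \<omega> \<le> ennreal (exp (\<theta> * c)) * ennreal (exp (- \<theta> * (\<Sum>t=1..n. h (Y t \<omega>))))"
    proof (cases "\<omega> \<in> ?E")
      case True
      then have "0 \<le> \<theta> * (c - (\<Sum>t=1..n. h (Y t \<omega>)))"
        using \<open>0 \<le> \<theta>\<close> unfolding E_eq by simp
      then have "1 \<le> exp (\<theta> * c) * exp (- \<theta> * (\<Sum>t=1..n. h (Y t \<omega>)))"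
        by (simp add: exp_add[symmetric] algebra_simps)
      then have "ennreal 1 \<le> ennreal (exp (\<theta> * c) * exp (- \<theta> * (\<Sum>t=1..n. h (Y t \<omega>))))"
        by (rule ennreal_leI)
      then show ?thesis using True by (simp add: ennreal_mult')
    qed simp
  qed
  also have "\<dots> = ennreal (exp (\<theta> * c)) * (\<integral>\<^sup>+ \<omega>. ennreal (exp (- \<theta> * (\<Sum>t=1..n. h (Y t \<omega>)))) \<partial>M)"
    by (rule nn_integral_cmult) measurable
  also have "\<dots> \<le> ennreal (exp (\<theta> * c)) * ennreal (exp s) ^ n"
    by (intro mult_left_mono H1_laplace_transform_le[OF H1 mu1 P_in_class h phi_le]) auto
  also have "\<dots> = ennreal (exp (\<theta> * c + real n * s))"
    by (simp add: ennreal_power ennreal_mult'[symmetric] exp_add exp_of_nat_mult)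
  finally show ?thesis
    by (simp add: emeasure_eq_measure)
qed

theorem theorem2p1:
  fixes S :: "'y measure"
    and \<mu>0 :: "'y measure"
    and \<mu>1 :: "real ^ 'w::finite \<Rightarrow> 'y measure"
    and \<P> :: "(real ^ 'w) set"
    and h :: "'y \<Rightarrow> real"
    and \<alpha> :: real
    and \<gamma> :: "nat \<Rightarrow> real"
    and M0 :: "'a measure" and Y0 :: "nat \<Rightarrow> 'a \<Rightarrow> 'y"
    and M1 :: "'b measure" and Y1 :: "nat \<Rightarrow> 'b \<Rightarrow> 'y"
    and F :: "nat \<Rightarrow> 'b measure" and P :: "nat \<Rightarrow> 'b \<Rightarrow> real ^ 'w"
  assumes mu0: "prob_measure_on S \<mu>0"
    and mu1: "\<And>p. p \<in> ntp_distributions \<Longrightarrow> prob_measure_on S (\<mu>1 p)"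
    and H0: "H0_model S \<mu>0 M0 Y0"
    and H1: "H1_model S \<mu>1 M1 F P Y1"
    and class_ntp: "\<P> \<subseteq> ntp_distributions"
    and alpha: "0 < \<alpha>" "\<alpha> < 1"
    and P_in_class: "\<And>t. t \<ge> 1 \<Longrightarrow> AE \<omega> in M1. P t \<omega> \<in> \<P>"
    and h_meas: "h \<in> borel_measurable S"
    and h_int: "integrable \<mu>0 (\<lambda>y. \<bar>h y\<bar>)"
    and level: "\<And>n. n \<ge> 1 \<Longrightarrow>
      measure M0 {\<omega> \<in> space M0. detection_rule h (\<gamma> n) n (\<lambda>t. Y0 t \<omega>) = 1} = \<alpha>"
  shows "limsup (\<lambda>n. ereal
           (measure M1 {\<omega> \<in> space M1. detection_rule h (\<gamma> n) n (\<lambda>t. Y1 t \<omega>) = 0}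
              powr (1 / real n)))
         \<le> ext_exp (- rate \<mu>0 \<mu>1 \<P> h)
       \<and> rate \<mu>0 \<mu>1 \<P> h =
         - (INF \<theta>\<in>{0..}. (ereal (\<theta> * (\<integral>y. h y \<partial>\<mu>0))
              + (SUP p\<in>\<P>. ext_log (phi h (\<mu>1 p) \<theta>))))"
proof
  interpret M1: prob_space M1 using H1 by (simp add: H1_model_def)
  \<comment> \<open>An almost sure membership under a probability measure cannot be in the empty
    set. Nonemptiness lets the constant leave the supremum and supplies a witness when that supremum
    is -infinity.\<close>
  have nonempty: "\<P> \<noteq> {}"
  proof
    assume "\<P> = {}"
    with P_in_class[of 1] show False by (simp add: M1.AE_False)
  qed
  show "rate \<mu>0 \<mu>1 \<P> h = - (INF \<theta>\<in>{0..}. (ereal (\<theta> * (\<integral>y. h y \<partial>\<mu>0))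
              + (SUP p\<in>\<P>. ext_log (phi h (\<mu>1 p) \<theta>))))"
    unfolding rate_def using nonempty by (simp add: SUP_ereal_add_right)
  have "h \<in> borel_measurable \<mu>0"
    using mu0 h_meas by (metis measurable_cong_sets prob_measure_on_def)
  then have int: "integrable \<mu>0 h"
    using h_int by (simp add: integrable_abs_iff)
  let ?m = "\<integral>y. h y \<partial>\<mu>0"
  let ?e = "\<lambda>n. measure M1 {\<omega> \<in> space M1. detection_rule h (\<gamma> n) n (\<lambda>t. Y1 t \<omega>) = 0}"
  let ?f = "\<lambda>\<theta>. SUP p\<in>\<P>. ereal (\<theta> * ?m) + ext_log (phi h (\<mu>1 p) \<theta>)"
  have "limsup (\<lambda>n. ereal (?e n powr (1 / real n))) \<le> ext_exp (?f \<theta>)" if "\<theta> \<in> {0..}" for \<theta>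
  proof (cases "?f \<theta>")
    case (real r)
    \<comment> \<open>A finite bound for all log \<open>phi\<close> over the class, chosen so that
      \<theta> (E_0 h + \<epsilon>) + s = r + \<theta> \<epsilon> is the final exponent.\<close>
    define s where "s = r - \<theta> * ?m"
    have phi_le: "phi h (\<mu>1 p) \<theta> \<le> ennreal (exp s)" if "p \<in> \<P>" for p
    proof (rule ext_log_le_imp)
      have "ereal (\<theta> * ?m) + ext_log (phi h (\<mu>1 p) \<theta>) \<le> ereal r"
        unfolding real[symmetric] using that by (rule SUP_upper)
      then show "ext_log (phi h (\<mu>1 p) \<theta>) \<le> ereal s"
        by (cases "ext_log (phi h (\<mu>1 p) \<theta>)") (auto simp: s_def)
    qed
    have error: "?e n \<le> exp (\<theta> * \<gamma> n + real n * s)" for n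
      using \<open>\<theta> \<in> {0..}\<close> by (intro type_II_error_le[OF H1 mu1 P_in_class h_meas phi_le]) auto
    have "limsup (\<lambda>n. ereal (?e n powr (1 / real n))) \<le> ereal (exp (r + \<theta> * \<epsilon>))" if "\<epsilon> > 0" for \<epsilon>
    proof (rule Limsup_bounded)
      have threshold: "\<forall>\<^sub>F n in sequentially. \<gamma> n \<le> real n * (?m + \<epsilon>)"
        by (rule threshold_eventually_le[OF H0 h_meas int alpha(1) that]) (rule level)
      show "\<forall>\<^sub>F n in sequentially. ereal (?e n powr (1 / real n)) \<le> ereal (exp (r + \<theta> * \<epsilon>))"
        using threshold eventually_ge_at_top[of 1]
      proof eventually_elim
        case (elim n)
        have "?e n powr (1 / n) \<le> exp (\<theta> * \<gamma> n + real n * s) powr (1 / n)"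
          using error[of n] \<open>\<theta> \<in> {0..}\<close> by (intro powr_mono2) auto
        also have "\<dots> = exp ((\<theta> * \<gamma> n + real n * s) / n)"
          by (simp add: powr_def)
        also have "\<dots> \<le> exp ((\<theta> * (real n * (?m + \<epsilon>)) + real n * s) / n)"
          using elim \<open>\<theta> \<in> {0..}\<close> by (simp add: divide_right_mono mult_left_mono)
        also have "(\<theta> * (real n * (?m + \<epsilon>)) + real n * s) / n = r + \<theta> * \<epsilon>"
          using elim by (simp add: s_def field_simps)
        finally show ?case by simp
      qed
    qed
    \<comment> \<open>The limsup does not depend on \<epsilon>, so it stays below the limit of the
      right-hand side as \<epsilon> decreases to 0.\<close>
    then have "\<forall>\<^sub>F \<epsilon> in at_right 0.
        limsup (\<lambda>n. ereal (?e n powr (1 / real n))) \<le> ereal (exp (r + \<theta> * \<epsilon>))"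
      by (auto simp: eventually_at_right_less eventually_at_filter)
    moreover have "((\<lambda>\<epsilon>. ereal (exp (r + \<theta> * \<epsilon>))) \<longlongrightarrow> ereal (exp (r + \<theta> * 0))) (at_right 0)"
      by (intro tendsto_intros)
    ultimately have "limsup (\<lambda>n. ereal (?e n powr (1 / real n))) \<le> ereal (exp (r + \<theta> * 0))"
      by (intro tendsto_lowerbound) auto
    then show ?thesis unfolding real by (simp add: ext_exp_def)
  next
    case MInf
    \<comment> \<open>This value cannot occur: any member of the class has positive
      \<open>phi\<close>, hence a logarithm above -infinity.\<close>
    obtain p where p: "p \<in> \<P>" using nonempty by auto
    then have "0 < phi h (\<mu>1 p) \<theta>"
      using class_ntp by (intro phi_pos[OF mu1 h_meas]) auto
    then have "ereal (\<theta> * ?m) + ext_log (phi h (\<mu>1 p) \<theta>) \<noteq> - \<infinity>"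
      by (auto simp: ext_log_def)
    moreover have "ereal (\<theta> * ?m) + ext_log (phi h (\<mu>1 p) \<theta>) \<le> - \<infinity>"
      unfolding MInf[symmetric] using p by (rule SUP_upper)
    ultimately show ?thesis by simp
  \<comment> \<open>In the remaining case the supremum is +infinity and the bound is
    trivial.\<close>
  qed (simp add: ext_exp_def)
  then have "limsup (\<lambda>n. ereal (?e n powr (1 / real n))) \<le> ext_exp (INF \<theta>\<in>{0..}. ?f \<theta>)"
    by (rule le_ext_exp_INF)
  then show "limsup (\<lambda>n. ereal (?e n powr (1 / real n))) \<le> ext_exp (- rate \<mu>0 \<mu>1 \<P> h)"
    by (simp add: rate_def)
qed

end
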